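(* Consider the DR-RC-Iterative-MPC scheme described in the context, and assume that the initial sampled safe set $\mathcal{S}^0$ consists of the states (with their cost-to-go) of a finite-length robustly safe trajectory from $x_S$ to $x_F$, in the sense specified in the context. Then, at each iteration $j\ge 1$ and each time-step $t\ge 0$, the finite-horizon problem $\mathcal{J}_{(\mathcal{S}^{j-1},\mathcal{D}^{j-1})}(x_t^j)$, i.e. the finite-horizon problem of the context with $x=x_t^j$, $\overline{\mathcal{S}}=\mathcal{S}^{j-1}$ and $\overline{\mathcal{D}}=\mathcal{D}^{j-1}$, which is solved in the scheme, is feasible. Further, the generated trajectory $(\mathsf{x}^j,\mathsf{u}^j)$ is $(\zeta,\mathbb{P}^{|\widehat{\mathcal{W}}^{j-1}|})$-safe, that is, $$\mathbb{P}^{|\widehat{\mathcal{W}}^{j-1}|}\left(\operatorname{CVaR}_\beta^{\mathbb{P}}\left[g(x_t^j,w)\right]\le\delta\right)\ge\zeta\quad\text{for all } t\in\{0,1,\dots,T_j\}.$$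
   Context: **System and cost.** The system is $x_{t+1}=f(x_t,u_t)$ with $f:\mathbb{R}^{n_x}\times\mathbb{R}^{n_u}\to\mathbb{R}^{n_x}$, subject to $x_t\in\mathcal{X}$, $u_t\in\mathcal{U}$, where $\mathcal{X},\mathcal{U}$ are compact convex sets. $x_S\in\mathcal{X}$ is the initial state and $x_F\in\mathcal{X}$ is a target equilibrium, $f(x_F,0)=x_F$, $0\in\mathcal{U}$. The stage cost $r:\mathcal{X}\times\mathcal{U}\to\mathbb{R}_{\ge0}$ is continuous with $r(x_F,0)=0$ and $r(x,u)>0$ for all $(x,u)\in(\mathcal{X}\times\mathcal{U})\setminus\{(x_F,0)\}$. **Risk.** $w$ is a random variable with distribution $\mathbb{P}$ supported on a compact set $\mathcal{W}\subset\mathbb{R}^{n_w}$; $g:\mathcal{X}\times\mathcal{W}\to\mathbb{R}$ is continuous; $\delta>0$; $\beta\in(0,1)$. For a distribution $\mu$, $\operatorname{CVaR}_\beta^\mu[Z]=\inf_{t\in\mathbb{R}}\{t+\beta^{-1}\mathbb{E}^\mu[\max(Z-t,0)]\}$. When applied to $g(x_t^j,w)$ under $\mathbb{P}$, the state $x_t^j$ is held fixed at its realized value and the risk is taken with respect to $w$ only. **Ambiguity sets.** Let $\mathcal{P}(\mathcal{W})$ be the set of distributions supported on $\mathcal{W}$. A confidence parameter $\zeta\in(0,1)$ and a set-valued map $\mathbb{D}:\bigcup_{i\ge1}\mathcal{W}^i\rightrightarrows\mathcal{P}(\mathcal{W})$ with closed nonempty values are given. At the start of iteration $j\ge1$ a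 dataset $\widehat{\mathcal{W}}^{j-1}$ of $N_{j-1}$ i.i.d. samples of $w$ drawn from $\mathbb{P}$ is available, $\mathcal{D}^{j-1}:=\mathbb{D}(\widehat{\mathcal{W}}^{j-1})$, and it is a standing assumption that $\mathbb{P}^{|\widehat{\mathcal{W}}^{j-1}|}(\mathbb{P}\in\mathcal{D}^{j-1})\ge\zeta$, where $\mathbb{P}^{|\widehat{\mathcal{W}}^{j-1}|}$ is the probability over the draw of the dataset. **Trajectories and cost-to-go.** The trajectory of iteration $j$ is $\mathsf{x}^j=[x_0^j,\dots,x_{T_j}^j]$, $\mathsf{u}^j=[u_0^j,\dots,u_{T_j-1}^j]$, with $x_0^j=x_S$; it is a standing assumption that each trajectory has finite length $T_j\in\mathbb{N}_{\ge1}$ and reaches $x_F$, and that for $t\ge T_j$ the state remains at $x_F$ with zero input. The cost-to-go is $J^j_{(t:\infty)}:=\sum_{k=t}^\infty r(x_k^j,u_k^j)$. **Sampled safe sets.** A sampled safe set $\overline{\mathcal{S}}$ is a finite set of triples (trajectory index, state, cost-to-go value). $\Pi_{\mathrm{state}}(\overline{\mathcal{S}})$ is the set of states appearing in $\overline{\mathcal{S}}$. The minimum cost-to-go $\overline{Q}$ of $\overline{\mathcal{S}}$ is $\overline{Q}(x)=\min\{J:(i,x,J)\in\overline{\mathcal{S}}\text{ for some }i\}$ if $x\in\Pi_{\mathrm{state}}(\overline{\mathcal{S}})$ and $+\infty$ otherwise. **Initialization.** $\mathcal{S}^0=\{(0,x_t^0,J^0_{(t:\infty)})\}_{t=0}^{T_0}$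 comes from a finite-length trajectory $\mathsf{x}^0=[x_0^0,\dots,x_{T_0}^0]$ with controls $\mathsf{u}^0=[u_0^0,\dots,u_{T_0-1}^0]$ in $\mathcal{U}$ satisfying the system dynamics, $x_0^0=x_S$, $x_{T_0}^0=x_F$ (remaining at $x_F$ with zero input afterwards), which is robustly safe: $x\in\mathcal{X}$ and $g(x,w)\le\delta$ for all $w\in\mathcal{W}$ and all $x\in\Pi_{\mathrm{state}}(\mathcal{S}^0)$. Set $\mathcal{I}^0=\{0\}$. **Finite-horizon problem.** Let $K\in\mathbb{N}_{\ge1}$. For a state $x$, sampled safe set $\overline{\mathcal{S}}$ with minimum cost-to-go $\overline{Q}$, and ambiguity set $\overline{\mathcal{D}}$, $\mathcal{J}_{(\overline{\mathcal{S}},\overline{\mathcal{D}})}(x)$ is the optimal value of: minimize $\sum_{k=0}^{K-1}r(x_k,u_k)+\overline{Q}(x_K)$ over $(x_0,\dots,x_K)$, $(u_0,\dots,u_{K-1})$ subject to $x_0=x$, $x_K\in\Pi_{\mathrm{state}}(\overline{\mathcal{S}})$, and for all $k\in\{0,\dots,K-1\}$: $x_{k+1}=f(x_k,u_k)$, $x_k\in\mathcal{X}$, $u_k\in\mathcal{U}$, $\sup_{\mu\in\overline{\mathcal{D}}}\operatorname{CVaR}_\beta^\mu[g(x_k,w)]\le\delta$. Whenever feasible, the minimum is taken to be attained. **DR-RC-Iterative-MPC.** For $j=1,2,\dots$: (1) Generate $(\mathsf{x}^j,\mathsf{u}^j)$ by the routine $\mathtt{DR\_MPC}(\mathcal{S}^{j-1},\mathcal{D}^{j-1})$: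 start from $x_0^j=x_S$; at each $t$ while $x_t^j\ne x_F$, solve the finite-horizon problem with $x=x_t^j$, $\overline{\mathcal{S}}=\mathcal{S}^{j-1}$, $\overline{\mathcal{D}}=\mathcal{D}^{j-1}$, let $u_t^j$ be the first element of an optimal input sequence, and set $x_{t+1}^j=f(x_t^j,u_t^j)$. (2) Append $T_j$ new samples (one per time-step) to $\widehat{\mathcal{W}}^{j-1}$ to obtain $\widehat{\mathcal{W}}^j$ (so $N_j=N_{j-1}+T_j$), and set $\mathcal{D}^j=\mathbb{D}(\widehat{\mathcal{W}}^j)$. (3) Let $\mathcal{S}'=\mathcal{S}^{j-1}\cup\{(j,x_t^j,J^j_{(t:\infty)})\}_{t=1}^{T_j}$; let $\mathcal{UI}^j$ be the set of indices $i\in\mathcal{I}^{j-1}\cup\{j\}$ for which there is $(i,x,J)\in\mathcal{S}'$ with $\sup_{\mu\in\mathcal{D}^j}\operatorname{CVaR}_\beta^\mu[g(x,w)]>\delta$; set $\mathcal{I}^j=(\mathcal{I}^{j-1}\cup\{j\})\setminus\mathcal{UI}^j$ and $\mathcal{S}^j=\{(i,x,J)\in\mathcal{S}':i\in\mathcal{I}^j\}$. *)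

theory Defs
  imports "HOL-Probability.Probability"
begin

definition cvar :: "real \<Rightarrow> 'w measure \<Rightarrow> ('w \<Rightarrow> real) \<Rightarrow> real" where
  "cvar \<beta> \<mu> Z = (INF t::real. t + (1 / \<beta>) * (\<integral>w. max (Z w - t) 0 \<partial>\<mu>))"

text \<open>Distributions supported on \<open>W\<close> are Borel probability measures on the subspace \<open>W\<close>.\<close>

definition distributions_on :: "'w::topological_space set \<Rightarrow> 'w measure set" where
  "distributions_on W = space (prob_algebra (restrict_space borel W))"

text \<open>The topology of weak convergence on \<open>distributions_on W\<close>, for compact \<open>W\<close>
  (continuous functions on \<open>W\<close> are then automatically bounded).\<close>

definition weak_topology :: "'w::topological_space set \<Rightarrow> 'w measure topology" where
  "weak_topology W = topology_generated_by
     {{\<mu> \<in> distributions_on W. (\<integral>w. \<phi> w \<partial>\<mu>) \<in> V} | (\<phi> :: 'w \<Rightarrow> real) V.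
        continuous_on W \<phi> \<and> open V}"

definition worst_case_cvar :: "real \<Rightarrow> 'w measure set \<Rightarrow> ('w \<Rightarrow> real) \<Rightarrow> ereal" where
  "worst_case_cvar \<beta> D Z = (SUP \<mu>\<in>D. ereal (cvar \<beta> \<mu> Z))"

text \<open>\<open>E\<close> has probability at least \<open>c\<close>. Events defined through optimal control choices need not be
  measurable, so this is the inner probability; see the next lemma for measurable events.\<close>

definition prob_at_least :: "'a measure \<Rightarrow> real \<Rightarrow> 'a set \<Rightarrow> bool" where
  "prob_at_least M c E \<longleftrightarrow> (\<exists>A\<in>sets M. A \<subseteq> E \<and> c \<le> measure M A)"

lemma (in prob_space) prob_at_least_iff_measure:
  assumes "E \<in> sets M"
  shows "prob_at_least M c E \<longleftrightarrow> c \<le> measure M E"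
proof
  assume "prob_at_least M c E"
  then obtain A where "A \<in> sets M" "A \<subseteq> E" "c \<le> measure M A"
    unfolding prob_at_least_def by blast
  moreover have "measure M A \<le> measure M E"
    using \<open>A \<subseteq> E\<close> assms by (rule finite_measure_mono)
  ultimately show "c \<le> measure M E" by linarith
next
  assume "c \<le> measure M E"
  then show "prob_at_least M c E"
    unfolding prob_at_least_def using assms by blast
qed

text \<open>Triples (trajectory index, state, cost-to-go value).\<close>

type_synonym 'n safe_set = "(nat \<times> (real ^ 'n) \<times> real) set"

definition safe_states :: "'n safe_set \<Rightarrow> (real ^ 'n) set" where
  "safe_states S = {x. \<exists>i J. (i, x, J) \<in> S}"

definition min_cost_to_go :: "'n safe_set \<Rightarrow> real ^ 'n \<Rightarrow> ereal" where
  "min_cost_to_go S x =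
     (if x \<in> safe_states S then ereal (Min {J. \<exists>i. (i, x, J) \<in> S}) else \<infinity>)"

definition cost_to_go ::
  "(real ^ 'n \<Rightarrow> real ^ 'm \<Rightarrow> real) \<Rightarrow> (nat \<Rightarrow> real ^ 'n) \<Rightarrow> (nat \<Rightarrow> real ^ 'm) \<Rightarrow> nat \<Rightarrow> real"
  where "cost_to_go r x u t = (\<Sum>k. r (x (t + k)) (u (t + k)))"

text \<open>Decision variables of the finite-horizon problem: only \<open>xs 0, \<dots>, xs K\<close> and
  \<open>us 0, \<dots>, us (K - 1)\<close> matter.\<close>

definition fh_feasible ::
  "(real ^ 'n \<Rightarrow> real ^ 'm \<Rightarrow> real ^ 'n) \<Rightarrow> (real ^ 'n) set \<Rightarrow> (real ^ 'm) set \<Rightarrow>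
   (real ^ 'n \<Rightarrow> real ^ 'w \<Rightarrow> real) \<Rightarrow> real \<Rightarrow> real \<Rightarrow> nat \<Rightarrow>
   'n safe_set \<Rightarrow> (real ^ 'w) measure set \<Rightarrow> real ^ 'n \<Rightarrow>
   (nat \<Rightarrow> real ^ 'n) \<Rightarrow> (nat \<Rightarrow> real ^ 'm) \<Rightarrow> bool" where
  "fh_feasible f X U g \<beta> \<delta> K S D x xs us \<longleftrightarrow>
     xs 0 = x \<and> xs K \<in> safe_states S \<and>
     (\<forall>k<K. xs (Suc k) = f (xs k) (us k) \<and> xs k \<in> X \<and> us k \<in> U \<and>
            worst_case_cvar \<beta> D (g (xs k)) \<le> ereal \<delta>)"

definition fh_cost ::
  "(real ^ 'n \<Rightarrow> real ^ 'm \<Rightarrow> real) \<Rightarrow> nat \<Rightarrow> 'n safe_set \<Rightarrow>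
   (nat \<Rightarrow> real ^ 'n) \<Rightarrow> (nat \<Rightarrow> real ^ 'm) \<Rightarrow> ereal" where
  "fh_cost r K S xs us = ereal (\<Sum>k<K. r (xs k) (us k)) + min_cost_to_go S (xs K)"

definition fh_value ::
  "(real ^ 'n \<Rightarrow> real ^ 'm \<Rightarrow> real ^ 'n) \<Rightarrow> (real ^ 'n \<Rightarrow> real ^ 'm \<Rightarrow> real) \<Rightarrow>
   (real ^ 'n) set \<Rightarrow> (real ^ 'm) set \<Rightarrow>
   (real ^ 'n \<Rightarrow> real ^ 'w \<Rightarrow> real) \<Rightarrow> real \<Rightarrow> real \<Rightarrow> nat \<Rightarrow>
   'n safe_set \<Rightarrow> (real ^ 'w) measure set \<Rightarrow> real ^ 'n \<Rightarrow> ereal" where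
  "fh_value f r X U g \<beta> \<delta> K S D x =
     Inf {fh_cost r K S xs us | xs us. fh_feasible f X U g \<beta> \<delta> K S D x xs us}"

definition fh_optimal ::
  "(real ^ 'n \<Rightarrow> real ^ 'm \<Rightarrow> real ^ 'n) \<Rightarrow> (real ^ 'n \<Rightarrow> real ^ 'm \<Rightarrow> real) \<Rightarrow>
   (real ^ 'n) set \<Rightarrow> (real ^ 'm) set \<Rightarrow>
   (real ^ 'n \<Rightarrow> real ^ 'w \<Rightarrow> real) \<Rightarrow> real \<Rightarrow> real \<Rightarrow> nat \<Rightarrow>
   'n safe_set \<Rightarrow> (real ^ 'w) measure set \<Rightarrow> real ^ 'n \<Rightarrow>
   (nat \<Rightarrow> real ^ 'n) \<Rightarrow> (nat \<Rightarrow> real ^ 'm) \<Rightarrow> bool" where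
  "fh_optimal f r X U g \<beta> \<delta> K S D x xs us \<longleftrightarrow>
     fh_feasible f X U g \<beta> \<delta> K S D x xs us \<and>
     fh_cost r K S xs us = fh_value f r X U g \<beta> \<delta> K S D x"

text \<open>A trajectory of length \<open>T\<close>, extended to all times by resting at \<open>xF\<close> with zero input.\<close>

definition rests_from :: "real ^ 'n \<Rightarrow> (nat \<Rightarrow> real ^ 'n) \<Rightarrow> (nat \<Rightarrow> real ^ 'm) \<Rightarrow> nat \<Rightarrow> bool" where
  "rests_from xF x u T \<longleftrightarrow> 1 \<le> T \<and> (\<forall>t\<ge>T. x t = xF \<and> u t = 0)"

definition robustly_safe_trajectory ::
  "(real ^ 'n \<Rightarrow> real ^ 'm \<Rightarrow> real ^ 'n) \<Rightarrow> (real ^ 'n) set \<Rightarrow> (real ^ 'm) set \<Rightarrow> (real ^ 'w) set \<Rightarrow>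
   (real ^ 'n \<Rightarrow> real ^ 'w \<Rightarrow> real) \<Rightarrow> real \<Rightarrow> real ^ 'n \<Rightarrow> real ^ 'n \<Rightarrow>
   (nat \<Rightarrow> real ^ 'n) \<Rightarrow> (nat \<Rightarrow> real ^ 'm) \<Rightarrow> nat \<Rightarrow> bool" where
  "robustly_safe_trajectory f X U W g \<delta> xS xF x u T \<longleftrightarrow>
     x 0 = xS \<and> rests_from xF x u T \<and>
     (\<forall>t<T. u t \<in> U \<and> x (Suc t) = f (x t) (u t)) \<and>
     (\<forall>t\<le>T. x t \<in> X \<and> (\<forall>w\<in>W. g (x t) w \<le> \<delta>))"

definition initial_safe_set ::
  "(real ^ 'n \<Rightarrow> real ^ 'm \<Rightarrow> real) \<Rightarrow> (nat \<Rightarrow> real ^ 'n) \<Rightarrow> (nat \<Rightarrow> real ^ 'm) \<Rightarrow> nat \<Rightarrow> 'n safe_set"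
  where "initial_safe_set r x u T = {(0, x t, cost_to_go r x u t) | t. t \<le> T}"

text \<open>\<open>x, u\<close> is the closed-loop trajectory of length \<open>T\<close>. The choice of the input is conditioned on
  solvability of the finite-horizon problem (an unsolvable problem leaves the input unspecified),
  so that feasibility is not built into this predicate.\<close>

definition DR_MPC ::
  "(real ^ 'n \<Rightarrow> real ^ 'm \<Rightarrow> real ^ 'n) \<Rightarrow> (real ^ 'n \<Rightarrow> real ^ 'm \<Rightarrow> real) \<Rightarrow>
   (real ^ 'n) set \<Rightarrow> (real ^ 'm) set \<Rightarrow>
   (real ^ 'n \<Rightarrow> real ^ 'w \<Rightarrow> real) \<Rightarrow> real \<Rightarrow> real \<Rightarrow> nat \<Rightarrow> real ^ 'n \<Rightarrow> real ^ 'n \<Rightarrow>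
   'n safe_set \<Rightarrow> (real ^ 'w) measure set \<Rightarrow>
   (nat \<Rightarrow> real ^ 'n) \<Rightarrow> (nat \<Rightarrow> real ^ 'm) \<Rightarrow> nat \<Rightarrow> bool" where
  "DR_MPC f r X U g \<beta> \<delta> K xS xF S D x u T \<longleftrightarrow>
     x 0 = xS \<and> rests_from xF x u T \<and>
     (\<forall>t<T. x t \<noteq> xF \<and> x (Suc t) = f (x t) (u t) \<and>
       ((\<exists>xs us. fh_optimal f r X U g \<beta> \<delta> K S D (x t) xs us) \<longrightarrow>
        (\<exists>xs us. fh_optimal f r X U g \<beta> \<delta> K S D (x t) xs us \<and> u t = us 0)))"

definition extended_safe_set ::
  "(real ^ 'n \<Rightarrow> real ^ 'm \<Rightarrow> real) \<Rightarrow> nat \<Rightarrow> 'n safe_set \<Rightarrow>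
   (nat \<Rightarrow> real ^ 'n) \<Rightarrow> (nat \<Rightarrow> real ^ 'm) \<Rightarrow> nat \<Rightarrow> 'n safe_set" where
  "extended_safe_set r j S x u T = S \<union> {(j, x t, cost_to_go r x u t) | t. 1 \<le> t \<and> t \<le> T}"

definition unsafe_indices ::
  "(real ^ 'n \<Rightarrow> real ^ 'w \<Rightarrow> real) \<Rightarrow> real \<Rightarrow> real \<Rightarrow>
   (real ^ 'w) measure set \<Rightarrow> 'n safe_set \<Rightarrow> nat set \<Rightarrow> nat set" where
  "unsafe_indices g \<beta> \<delta> D S I =
     {i \<in> I. \<exists>x J. (i, x, J) \<in> S \<and> worst_case_cvar \<beta> D (g x) > ereal \<delta>}"

text \<open>The dataset consisting of the first \<open>n\<close> elements of the sample sequence \<open>\<omega>\<close>.\<close>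

definition dataset :: "(nat \<Rightarrow> 'w) \<Rightarrow> nat \<Rightarrow> 'w list" where
  "dataset \<omega> n = map \<omega> [0..<n]"

text \<open>One run of the scheme along the sample sequence \<open>\<omega>\<close>. For \<open>j \<ge> 1\<close>, the trajectory of
  iteration \<open>j\<close> is \<open>x j, u j\<close> with length \<open>T j\<close> (the entries for \<open>j = 0\<close> are not used: the initial
  trajectory enters through \<open>S0\<close>). After iteration \<open>j\<close> there are \<open>N j\<close> samples, the ambiguity set is
  \<open>DD (dataset \<omega> (N j))\<close>, the retained trajectory indices are \<open>I j\<close> and the sampled
  safe set is \<open>S j\<close>.\<close>

definition DR_RC_Iterative_MPC ::
  "(real ^ 'n \<Rightarrow> real ^ 'm \<Rightarrow> real ^ 'n) \<Rightarrow> (real ^ 'n \<Rightarrow> real ^ 'm \<Rightarrow> real) \<Rightarrow>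
   (real ^ 'n) set \<Rightarrow> (real ^ 'm) set \<Rightarrow>
   (real ^ 'n \<Rightarrow> real ^ 'w \<Rightarrow> real) \<Rightarrow> real \<Rightarrow> real \<Rightarrow> nat \<Rightarrow> real ^ 'n \<Rightarrow> real ^ 'n \<Rightarrow>
   ((real ^ 'w) list \<Rightarrow> (real ^ 'w) measure set) \<Rightarrow> nat \<Rightarrow> 'n safe_set \<Rightarrow>
   (nat \<Rightarrow> real ^ 'w) \<Rightarrow>
   (nat \<Rightarrow> nat \<Rightarrow> real ^ 'n) \<Rightarrow> (nat \<Rightarrow> nat \<Rightarrow> real ^ 'm) \<Rightarrow> (nat \<Rightarrow> nat) \<Rightarrow>
   (nat \<Rightarrow> nat) \<Rightarrow> (nat \<Rightarrow> nat set) \<Rightarrow> (nat \<Rightarrow> 'n safe_set) \<Rightarrow> bool" where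
  "DR_RC_Iterative_MPC f r X U g \<beta> \<delta> K xS xF DD N0 S0 \<omega> x u T N I S \<longleftrightarrow>
     N 0 = N0 \<and> I 0 = {0} \<and> S 0 = S0 \<and>
     (\<forall>j\<ge>1.
        DR_MPC f r X U g \<beta> \<delta> K xS xF (S (j - 1)) (DD (dataset \<omega> (N (j - 1)))) (x j) (u j) (T j) \<and>
        N j = N (j - 1) + T j \<and>
        (let S' = extended_safe_set r j (S (j - 1)) (x j) (u j) (T j);
             UI = unsafe_indices g \<beta> \<delta> (DD (dataset \<omega> (N j))) S' (I (j - 1) \<union> {j})
         in I j = (I (j - 1) \<union> {j}) - UI \<and>
            S j = {(i, y, J). (i, y, J) \<in> S' \<and> i \<in> I j}))"

end

theory Submission
  imports Defs
begin

text \<open>The sampled safe set is an invariant set that carries its own controller. Each stored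
  trajectory runs into the equilibrium \<open>xF\<close>, so every stored state has an admissible input that
  leads to another stored state of the \<^emph>\<open>same\<close> trajectory (\<open>xF\<close> itself is held by the zero
  input). Since trajectories are discarded as a whole, this survives the pruning step
  (\<open>self_controlled_prune\<close>), and what remains after pruning meets the risk constraint for the
  current ambiguity set by construction. The initial trajectory is never discarded: its states are
  safe for every realization of the uncertainty, hence the risk at them is at most \<open>\<delta>\<close> under
  every distribution on \<open>W\<close> (\<open>worst_case_cvar_le\<close>). So \<open>xS\<close> and \<open>xF\<close> always stay
  in the safe set, and \<open>safe_set_invariant\<close> collects all this by induction over the iterations.

  Within one iteration the usual argument for recursive feasibility of predictive control applies:
  from a stored state such as \<open>xS\<close>, admissible inputs that remain among the stored states form a
  feasible plan (\<open>feasible_from_safe_state\<close>), and an optimal plan, shifted by one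
  step and continued by an input that keeps its terminal state among the stored ones, is feasible for the next state (\<open>feasible_shift\<close>).

  Feasibility at a state includes the risk constraint there, for all distributions in the ambiguity
  set. On the event that the ambiguity set contains \<open>P\<close>, the constraint therefore holds under
  \<open>P\<close>, and that event has probability at least \<open>\<zeta>\<close>.\<close>

section \<open>Risk of a bounded loss\<close>

text \<open>The value of the objective at \<open>t = c\<close> is \<open>c\<close>. The work lies in showing that the infimum
  is over a set that is bounded below, by the lower bound \<open>a\<close> of the loss; \<open>\<beta> \<le> 1\<close> makes the
  expectation term compensate the decrease of \<open>t\<close> below \<open>a\<close>.\<close>

lemma cvar_le:
  assumes "prob_space \<mu>" and Z: "Z \<in> borel_measurable \<mu>"
    and bounds: "\<And>w. w \<in> space \<mu> \<Longrightarrow> a \<le> Z w" "\<And>w. w \<in> space \<mu> \<Longrightarrow> Z w \<le> c"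
    and \<beta>: "0 < \<beta>" "\<beta> \<le> 1"
  shows "cvar \<beta> \<mu> Z \<le> c"
proof -
  interpret prob_space \<mu> by fact
  let ?F = "\<lambda>t. t + (1 / \<beta>) * (\<integral>w. max (Z w - t) 0 \<partial>\<mu>)"
  have below: "a \<le> ?F t" for t
  proof (cases "a \<le> t")
    case True
    have "0 \<le> (\<integral>w. max (Z w - t) 0 \<partial>\<mu>)" by (rule integral_nonneg_AE) auto
    then have "0 \<le> (1 / \<beta>) * (\<integral>w. max (Z w - t) 0 \<partial>\<mu>)" using \<beta> by simp
    then show ?thesis using True by linarith
  next
    case False
    have "integrable \<mu> (\<lambda>w. max (Z w - t) 0)"
    proof (rule integrable_const_bound)
      show "AE w in \<mu>. norm (max (Z w - t) 0) \<le> \<bar>c - t\<bar>"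
        using bounds(2) by (intro AE_I2) (fastforce simp: max_def abs_if)
      show "(\<lambda>w. max (Z w - t) 0) \<in> borel_measurable \<mu>" using Z by measurable
    qed
    then have "(\<integral>w. a - t \<partial>\<mu>) \<le> (\<integral>w. max (Z w - t) 0 \<partial>\<mu>)"
      using bounds(1) by (intro integral_mono) (simp_all add: max.coboundedI1)
    then have le: "a - t \<le> (\<integral>w. max (Z w - t) 0 \<partial>\<mu>)" by (simp add: prob_space)
    also have "\<dots> \<le> (1 / \<beta>) * (\<integral>w. max (Z w - t) 0 \<partial>\<mu>)"
    proof -
      have "0 \<le> (\<integral>w. max (Z w - t) 0 \<partial>\<mu>)" using False le by linarith
      moreover have "1 \<le> 1 / \<beta>" using \<beta> by simp
      ultimately show ?thesis using mult_right_mono by fastforce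
    qed
    finally show ?thesis by linarith
  qed
  have "(\<integral>w. max (Z w - c) 0 \<partial>\<mu>) = (\<integral>w. 0 \<partial>\<mu>)"
    using bounds(2) by (intro Bochner_Integration.integral_cong) (auto simp: max_def intro: antisym)
  then have "?F c = c" by simp
  moreover have "(INF t. ?F t) \<le> ?F c"
    using below by (intro cINF_lower) (auto intro!: bdd_belowI)
  ultimately show ?thesis unfolding cvar_def by (rule ord_le_eq_trans[rotated])
qed

lemma distributions_onD:
  assumes "\<mu> \<in> distributions_on W"
  shows "prob_space \<mu>" and "sets \<mu> = sets (restrict_space borel W)" and "space \<mu> = W"
proof -
  show "prob_space \<mu>" and sets: "sets \<mu> = sets (restrict_space borel W)"
    using assms by (auto simp: distributions_on_def space_prob_algebra)
  show "space \<mu> = W"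
    using sets_eq_imp_space_eq[OF sets] by (simp add: space_restrict_space)
qed

lemma worst_case_cvar_le:
  fixes Z :: "'w::t2_space \<Rightarrow> real"
  assumes W: "compact W" and Z: "continuous_on W Z" and le: "\<And>w. w \<in> W \<Longrightarrow> Z w \<le> \<delta>"
    and \<beta>: "0 < \<beta>" "\<beta> \<le> 1" and D: "D \<subseteq> distributions_on W"
  shows "worst_case_cvar \<beta> D Z \<le> ereal \<delta>"
  unfolding worst_case_cvar_def
proof (rule SUP_least)
  fix \<mu> assume "\<mu> \<in> D"
  then have \<mu>: "prob_space \<mu>" "sets \<mu> = sets (restrict_space borel W)" and space: "space \<mu> = W"
    using D distributions_onD by blast+
  have "Z \<in> borel_measurable \<mu>"
    using borel_measurable_continuous_on_restrict[OF Z] \<mu>(2) measurable_cong_sets by blast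
  moreover obtain a where "\<And>w. w \<in> W \<Longrightarrow> a \<le> Z w"
    using bounded_imp_bdd_below[OF compact_imp_bounded[OF compact_continuous_image[OF Z W]]]
    unfolding bdd_below_def by blast
  ultimately have "cvar \<beta> \<mu> Z \<le> \<delta>"
    using le space by (intro cvar_le[OF \<mu>(1) _ _ _ \<beta>, where a = a]) auto
  then show "ereal (cvar \<beta> \<mu> Z) \<le> ereal \<delta>" by simp
qed

lemma cvar_le_of_worst_case:
  assumes "worst_case_cvar \<beta> D Z \<le> ereal \<delta>" and "\<mu> \<in> D"
  shows "cvar \<beta> \<mu> Z \<le> \<delta>"
proof -
  have "ereal (cvar \<beta> \<mu> Z) \<le> worst_case_cvar \<beta> D Z"
    unfolding worst_case_cvar_def using assms(2) by (rule SUP_upper)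
  with assms(1) have "ereal (cvar \<beta> \<mu> Z) \<le> ereal \<delta>" by (rule order_trans[rotated])
  then show ?thesis by simp
qed

lemma prob_at_least_mono:
  assumes "prob_at_least M c E" and "E \<subseteq> F"
  shows "prob_at_least M c F"
  using assms unfolding prob_at_least_def by blast

section \<open>Recursive feasibility within one iteration\<close>

text \<open>The successor has to carry the same index: only then is the property preserved when some
  indices are discarded.\<close>

definition self_controlled ::
  "(real ^ 'n \<Rightarrow> real ^ 'm \<Rightarrow> real ^ 'n) \<Rightarrow> (real ^ 'n) set \<Rightarrow> (real ^ 'm) set \<Rightarrow> 'n safe_set \<Rightarrow> bool"
  where "self_controlled f X U S \<longleftrightarrow>
    (\<forall>i y J. (i, y, J) \<in> S \<longrightarrow> y \<in> X \<and> (\<exists>v\<in>U. \<exists>J'. (i, f y v, J') \<in> S))"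

definition risk_safe ::
  "(real ^ 'n \<Rightarrow> real ^ 'w \<Rightarrow> real) \<Rightarrow> real \<Rightarrow> real \<Rightarrow> 'n safe_set \<Rightarrow> (real ^ 'w) measure set \<Rightarrow> bool"
  where "risk_safe g \<beta> \<delta> S D \<longleftrightarrow>
    (\<forall>y\<in>safe_states S. worst_case_cvar \<beta> D (g y) \<le> ereal \<delta>)"

lemma self_controlled_step:
  assumes "self_controlled f X U S" and "y \<in> safe_states S"
  obtains v where "y \<in> X" "v \<in> U" "f y v \<in> safe_states S"
  using assms unfolding self_controlled_def safe_states_def by blast

lemma feasible_from_safe_state:
  assumes sc: "self_controlled f X U S" and rs: "risk_safe g \<beta> \<delta> S D"
    and y: "y \<in> safe_states S"
  shows "\<exists>xs us. fh_feasible f X U g \<beta> \<delta> K S D y xs us"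
proof -
  have "\<forall>z. \<exists>v. z \<in> safe_states S \<longrightarrow> z \<in> X \<and> v \<in> U \<and> f z v \<in> safe_states S"
    using self_controlled_step[OF sc] by metis
  then obtain \<kappa> where \<kappa>:
    "\<And>z. z \<in> safe_states S \<Longrightarrow> z \<in> X \<and> \<kappa> z \<in> U \<and> f z (\<kappa> z) \<in> safe_states S" by metis
  define xs where "xs k = ((\<lambda>z. f z (\<kappa> z)) ^^ k) y" for k
  have safe: "xs k \<in> safe_states S" for k
    by (induction k) (auto simp: xs_def y \<kappa>)
  have "fh_feasible f X U g \<beta> \<delta> K S D y xs (\<lambda>k. \<kappa> (xs k))"
    unfolding fh_feasible_def
    using safe \<kappa>[OF safe] rs by (auto simp: risk_safe_def) (auto simp: xs_def)
  then show ?thesis by blast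
qed

lemma feasible_shift:
  assumes sc: "self_controlled f X U S" and rs: "risk_safe g \<beta> \<delta> S D" and K: "1 \<le> K"
    and feas: "fh_feasible f X U g \<beta> \<delta> K S D y xs us"
  shows "\<exists>xs' us'. fh_feasible f X U g \<beta> \<delta> K S D (f y (us 0)) xs' us'"
proof -
  have xs: "xs 0 = y" "xs K \<in> safe_states S"
    and step: "\<And>k. k < K \<Longrightarrow> xs (Suc k) = f (xs k) (us k) \<and> xs k \<in> X \<and> us k \<in> U \<and>
        worst_case_cvar \<beta> D (g (xs k)) \<le> ereal \<delta>"
    using feas unfolding fh_feasible_def by blast+
  obtain v where v: "xs K \<in> X" "v \<in> U" "f (xs K) v \<in> safe_states S"
    using self_controlled_step[OF sc xs(2)] .
  have risk: "worst_case_cvar \<beta> D (g (xs K)) \<le> ereal \<delta>"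
    using rs xs(2) unfolding risk_safe_def by blast
  define xs' where "xs' k = (if k < K then xs (Suc k) else f (xs K) v)" for k
  define us' where "us' k = (if Suc k < K then us (Suc k) else v)" for k
  have "xs' (Suc k) = f (xs' k) (us' k) \<and> xs' k \<in> X \<and> us' k \<in> U \<and>
      worst_case_cvar \<beta> D (g (xs' k)) \<le> ereal \<delta>" if "k < K" for k
  proof (cases "Suc k < K")
    case True
    then show ?thesis using step[of "Suc k"] by (simp add: xs'_def us'_def)
  next
    case False
    with that have "Suc k = K" by simp
    with that v risk show ?thesis by (simp add: xs'_def us'_def)
  qed
  moreover have "xs' 0 = f y (us 0)" using K step[of 0] xs(1) by (simp add: xs'_def)
  moreover have "xs' K \<in> safe_states S" using v by (simp add: xs'_def)
  ultimately show ?thesis unfolding fh_feasible_def by blast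
qed

lemma closed_loop_feasible:
  assumes sc: "self_controlled f X U S" and rs: "risk_safe g \<beta> \<delta> S D" and K: "1 \<le> K"
    and ends: "xS \<in> safe_states S" "xF \<in> safe_states S"
    and mpc: "DR_MPC f r X U g \<beta> \<delta> K xS xF S D x u T"
    and attained: "\<And>y. \<exists>xs us. fh_feasible f X U g \<beta> \<delta> K S D y xs us \<Longrightarrow>
      \<exists>xs us. fh_optimal f r X U g \<beta> \<delta> K S D y xs us"
  shows "\<exists>xs us. fh_feasible f X U g \<beta> \<delta> K S D (x t) xs us"
proof (induction t)
  case 0
  then show ?case using feasible_from_safe_state[OF sc rs ends(1)] mpc
    unfolding DR_MPC_def by simp
next
  case (Suc t)
  show ?case
  proof (cases "t < T")
    case True
    with attained[OF Suc] mpc obtain xs us where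
      "fh_optimal f r X U g \<beta> \<delta> K S D (x t) xs us" "u t = us 0" "x (Suc t) = f (x t) (u t)"
      unfolding DR_MPC_def by metis
    then show ?thesis using feasible_shift[OF sc rs K] unfolding fh_optimal_def by metis
  next
    case False
    then have "x (Suc t) = xF" using mpc unfolding DR_MPC_def rests_from_def by simp
    then show ?thesis using feasible_from_safe_state[OF sc rs ends(2)] by simp
  qed
qed

lemma feasible_imp_safe:
  assumes "fh_feasible f X U g \<beta> \<delta> K S D y xs us" and "1 \<le> K"
  shows "y \<in> X" and "us 0 \<in> U" and "worst_case_cvar \<beta> D (g y) \<le> ereal \<delta>"
  using assms unfolding fh_feasible_def by (metis One_nat_def Suc_le_eq)+

section \<open>Invariance of the sampled safe set across iterations\<close>

lemma self_controlled_Un: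
  "self_controlled f X U A \<Longrightarrow> self_controlled f X U B \<Longrightarrow> self_controlled f X U (A \<union> B)"
  unfolding self_controlled_def by blast

lemma self_controlled_prune:
  "self_controlled f X U A \<Longrightarrow> self_controlled f X U {(i, y, J). (i, y, J) \<in> A \<and> i \<in> I}"
  unfolding self_controlled_def by blast

text \<open>A trajectory may be stored from any time \<open>a\<close> on, because only its successors matter; after
  its last step it is continued by resting at the equilibrium.\<close>

lemma self_controlled_trajectory:
  assumes eq: "f xF 0 = xF" "0 \<in> U" and rest: "x T = xF"
    and X: "\<And>t. t \<le> T \<Longrightarrow> x t \<in> X"
    and step: "\<And>t. t < T \<Longrightarrow> u t \<in> U \<and> x (Suc t) = f (x t) (u t)"
  shows "self_controlled f X U {(i, x t, c t) | t. a \<le> t \<and> t \<le> T}"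
  unfolding self_controlled_def
proof (intro allI impI)
  fix i' y J assume "(i', y, J) \<in> {(i, x t, c t) | t. a \<le> t \<and> t \<le> T}"
  then obtain t where t: "i' = i" "y = x t" "a \<le> t" "t \<le> T" by blast
  show "y \<in> X \<and> (\<exists>v\<in>U. \<exists>J'. (i', f y v, J') \<in> {(i, x t, c t) | t. a \<le> t \<and> t \<le> T})"
  proof (cases "t = T")
    case True
    then have "(i', f y 0, c T) \<in> {(i, x t, c t) | t. a \<le> t \<and> t \<le> T}"
      using t eq rest by auto
    then show ?thesis using t X eq by blast
  next
    case False
    with t have "u t \<in> U" "f y (u t) = x (Suc t)" "a \<le> Suc t" "Suc t \<le> T"
      using step[of t] by simp_all
    then have "u t \<in> U" "(i', f y (u t), c (Suc t)) \<in> {(i, x t, c t) | t. a \<le> t \<and> t \<le> T}"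
      using t(1) by blast+
    then show ?thesis using t X by blast
  qed
qed

text \<open>The inputs of the closed loop are admissible, and its states stay in \<open>X\<close>, because each
  input is the first one of a feasible plan.\<close>

lemma self_controlled_extend:
  assumes sc: "self_controlled f X U S" and K: "1 \<le> K"
    and eq: "f xF 0 = xF" "0 \<in> U"
    and mpc: "DR_MPC f r X U g \<beta> \<delta> K xS xF S D x u T"
    and feas: "\<And>t. \<exists>xs us. fh_feasible f X U g \<beta> \<delta> K S D (x t) xs us"
    and attained: "\<And>y. \<exists>xs us. fh_feasible f X U g \<beta> \<delta> K S D y xs us \<Longrightarrow>
      \<exists>xs us. fh_optimal f r X U g \<beta> \<delta> K S D y xs us"
  shows "self_controlled f X U (extended_safe_set r j S x u T)"
  unfolding extended_safe_set_def
proof (intro self_controlled_Un[OF sc] self_controlled_trajectory)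
  show "x T = xF" using mpc unfolding DR_MPC_def rests_from_def by blast
  show "x t \<in> X" for t using feas[of t] feasible_imp_safe(1)[OF _ K] by blast
  show "u t \<in> U \<and> x (Suc t) = f (x t) (u t)" if t: "t < T" for t
  proof -
    from attained[OF feas] mpc t obtain xs us where
      "fh_optimal f r X U g \<beta> \<delta> K S D (x t) xs us" "u t = us 0" "x (Suc t) = f (x t) (u t)"
      unfolding DR_MPC_def by metis
    then show ?thesis using feasible_imp_safe(2)[OF _ K] unfolding fh_optimal_def by metis
  qed
qed (fact eq)+

lemma risk_safe_prune:
  assumes "I' = I - unsafe_indices g \<beta> \<delta> D A I"
  shows "risk_safe g \<beta> \<delta> {(i, y, J). (i, y, J) \<in> A \<and> i \<in> I'} D"
  unfolding risk_safe_def
proof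
  fix y assume "y \<in> safe_states {(i, y, J). (i, y, J) \<in> A \<and> i \<in> I'}"
  then obtain i J where "(i, y, J) \<in> A" "i \<in> I'" unfolding safe_states_def by blast
  then have "\<not> worst_case_cvar \<beta> D (g y) > ereal \<delta>"
    using assms unfolding unsafe_indices_def by blast
  then show "worst_case_cvar \<beta> D (g y) \<le> ereal \<delta>" by simp
qed

text \<open>That the triples with index \<open>0\<close> are exactly those of the initial safe set is what keeps
  index \<open>0\<close> alive: no later trajectory can make it unsafe.\<close>

lemma safe_set_invariant:
  assumes eq: "xF \<in> X" "f xF 0 = xF" "0 \<in> U" and K: "1 \<le> K"
    and init: "robustly_safe_trajectory f X U W g \<delta> xS xF x0 u0 T0"
    and S0: "S0 = initial_safe_set r x0 u0 T0"
    and scheme: "DR_RC_Iterative_MPC f r X U g \<beta> \<delta> K xS xF DD N0 S0 \<omega> x u T N I S"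
    and D: "\<And>j. D j = DD (dataset \<omega> (N j))"
    and S0_safe: "\<And>j. risk_safe g \<beta> \<delta> S0 (D j)"
    and attained: "\<And>j y. 1 \<le> j \<Longrightarrow>
      \<exists>xs us. fh_feasible f X U g \<beta> \<delta> K (S (j - 1)) (D (j - 1)) y xs us \<Longrightarrow>
      \<exists>xs us. fh_optimal f r X U g \<beta> \<delta> K (S (j - 1)) (D (j - 1)) y xs us"
  shows "self_controlled f X U (S j) \<and> risk_safe g \<beta> \<delta> (S j) (D j) \<and>
    0 \<in> I j \<and> {(i, y, J). (i, y, J) \<in> S j \<and> i = 0} = S0 \<and>
    (\<forall>t. \<exists>xs us. fh_feasible f X U g \<beta> \<delta> K (S j) (D j) (x (Suc j) t) xs us)"
proof -
  have x0: "x0 0 = xS" "x0 T0 = xF" "\<And>t. t \<le> T0 \<Longrightarrow> x0 t \<in> X"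
    "\<And>t. t < T0 \<Longrightarrow> u0 t \<in> U \<and> x0 (Suc t) = f (x0 t) (u0 t)"
    using init unfolding robustly_safe_trajectory_def rests_from_def by auto
  have ends: "xS \<in> safe_states S0" "xF \<in> safe_states S0"
    unfolding S0 initial_safe_set_def safe_states_def using x0(1,2) by blast+
  have S_start: "S 0 = S0" "I 0 = {0}"
    using scheme unfolding DR_RC_Iterative_MPC_def by blast+
  have mpc: "DR_MPC f r X U g \<beta> \<delta> K xS xF (S j) (D j) (x (Suc j)) (u (Suc j)) (T (Suc j))" for j
  proof -
    have "1 \<le> Suc j" by simp
    with scheme show ?thesis unfolding DR_RC_Iterative_MPC_def D by (metis diff_Suc_1)
  qed
  have feasible: "\<exists>xs us. fh_feasible f X U g \<beta> \<delta> K (S j) (D j) (x (Suc j) t) xs us"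
    if "self_controlled f X U (S j)" "risk_safe g \<beta> \<delta> (S j) (D j)"
      "{(i, y, J). (i, y, J) \<in> S j \<and> i = 0} = S0" for j t
  proof (rule closed_loop_feasible[OF that(1,2) K _ _ mpc])
    have "safe_states S0 \<subseteq> safe_states (S j)"
      using that(3) unfolding safe_states_def by blast
    then show "xS \<in> safe_states (S j)" "xF \<in> safe_states (S j)" using ends by blast+
  qed (use attained[of "Suc j"] in simp)
  have "self_controlled f X U (S j) \<and> risk_safe g \<beta> \<delta> (S j) (D j) \<and>
    0 \<in> I j \<and> {(i, y, J). (i, y, J) \<in> S j \<and> i = 0} = S0"
  proof (induction j)
    case 0
    have "self_controlled f X U {(0, x0 t, cost_to_go r x0 u0 t) | t. 0 \<le> t \<and> t \<le> T0}"
      by (rule self_controlled_trajectory[OF eq(2,3) x0(2-4)])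
    then have "self_controlled f X U S0" by (simp add: S0 initial_safe_set_def)
    moreover have "{(i, y, J). (i, y, J) \<in> S0 \<and> i = 0} = S0"
      unfolding S0 initial_safe_set_def by auto
    ultimately show ?case
      unfolding S_start by (intro conjI S0_safe insertI1)
  next
    case (Suc j)
    then have sc: "self_controlled f X U (S j)" and rs: "risk_safe g \<beta> \<delta> (S j) (D j)"
      and I0: "0 \<in> I j" and idx0: "{(i, y, J). (i, y, J) \<in> S j \<and> i = 0} = S0" by blast+
    define S' where
      "S' = extended_safe_set r (Suc j) (S j) (x (Suc j)) (u (Suc j)) (T (Suc j))"
    define I' where "I' = I j \<union> {Suc j}"
    have I: "I (Suc j) = I' - unsafe_indices g \<beta> \<delta> (D (Suc j)) S' I'"
      and S: "S (Suc j) = {(i, y, J). (i, y, J) \<in> S' \<and> i \<in> I (Suc j)}"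
      using scheme[unfolded DR_RC_Iterative_MPC_def Let_def] unfolding S'_def I'_def D
      by (auto dest!: spec[of _ "Suc j"])
    have idx0': "{(i, y, J). (i, y, J) \<in> S' \<and> i = 0} = S0"
      using idx0 unfolding S'_def extended_safe_set_def by auto
    have "worst_case_cvar \<beta> (D (Suc j)) (g y) \<le> ereal \<delta>" if "(0, y, J) \<in> S'" for y J
    proof -
      have "(0, y, J) \<in> S0" using that idx0' by blast
      then show ?thesis
        using S0_safe unfolding risk_safe_def safe_states_def by blast
    qed
    then have "0 \<in> I (Suc j)"
      using I0 unfolding I I'_def unsafe_indices_def by (auto simp flip: not_less)
    moreover from this have "{(i, y, J). (i, y, J) \<in> S (Suc j) \<and> i = 0} = S0"
      using idx0' unfolding S by auto
    moreover have "self_controlled f X U S'"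
      unfolding S'_def
      by (rule self_controlled_extend[OF sc K eq(2,3) mpc feasible[OF sc rs idx0]])
        (use attained[of "Suc j"] in simp)
    then have "self_controlled f X U (S (Suc j))"
      unfolding S by (rule self_controlled_prune)
    moreover have "risk_safe g \<beta> \<delta> (S (Suc j)) (D (Suc j))"
      unfolding S by (rule risk_safe_prune[OF I])
    ultimately show ?case by blast
  qed
  then show ?thesis using feasible by blast
qed

lemma dataset_nonempty:
  assumes "DR_RC_Iterative_MPC f r X U g \<beta> \<delta> K xS xF DD N0 S0 \<omega> x u T N I S" and "1 \<le> N0"
  shows "dataset \<omega> (N j) \<noteq> []"
proof -
  have N: "N 0 = N0" "\<And>j. 1 \<le> j \<Longrightarrow> N j = N (j - 1) + T j"
    using assms(1) unfolding DR_RC_Iterative_MPC_def by blast+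
  have "1 \<le> N j"
    by (induction j) (use N assms(2) in \<open>auto simp: le_SucI\<close>)
  then show ?thesis unfolding dataset_def by simp
qed

section \<open>Feasibility and safety of the scheme\<close>

theorem propositionV1:
  fixes f :: "real ^ 'n \<Rightarrow> real ^ 'm \<Rightarrow> real ^ 'n"
    and r :: "real ^ 'n \<Rightarrow> real ^ 'm \<Rightarrow> real"
    and X :: "(real ^ 'n) set" and U :: "(real ^ 'm) set"
    and xS xF :: "real ^ 'n"
    and W :: "(real ^ 'w) set" and P :: "(real ^ 'w) measure"
    and g :: "real ^ 'n \<Rightarrow> real ^ 'w \<Rightarrow> real"
    and \<beta> \<delta> \<zeta> :: real
    and DD :: "(real ^ 'w) list \<Rightarrow> (real ^ 'w) measure set"
    and K N0 T0 :: nat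
    and x0 :: "nat \<Rightarrow> real ^ 'n" and u0 :: "nat \<Rightarrow> real ^ 'm"
    and \<Omega> :: "(nat \<Rightarrow> real ^ 'w) measure"
    and x :: "(nat \<Rightarrow> real ^ 'w) \<Rightarrow> nat \<Rightarrow> nat \<Rightarrow> real ^ 'n"
    and u :: "(nat \<Rightarrow> real ^ 'w) \<Rightarrow> nat \<Rightarrow> nat \<Rightarrow> real ^ 'm"
    and T N :: "(nat \<Rightarrow> real ^ 'w) \<Rightarrow> nat \<Rightarrow> nat"
    and I :: "(nat \<Rightarrow> real ^ 'w) \<Rightarrow> nat \<Rightarrow> nat set"
    and S :: "(nat \<Rightarrow> real ^ 'w) \<Rightarrow> nat \<Rightarrow> 'n safe_set"
    and D :: "(nat \<Rightarrow> real ^ 'w) \<Rightarrow> nat \<Rightarrow> (real ^ 'w) measure set"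
  assumes X: "compact X" "convex X" and U: "compact U" "convex U"
    and points: "xS \<in> X" "xF \<in> X" "f xF 0 = xF" "0 \<in> U"
    and r_cont: "continuous_on (X \<times> U) (\<lambda>(y, v). r y v)"
    and r_nonneg: "\<And>y v. y \<in> X \<Longrightarrow> v \<in> U \<Longrightarrow> 0 \<le> r y v"
    and r_zero: "r xF 0 = 0"
    and r_pos: "\<And>y v. y \<in> X \<Longrightarrow> v \<in> U \<Longrightarrow> (y, v) \<noteq> (xF, 0) \<Longrightarrow> 0 < r y v"
    and W: "compact W" and P: "P \<in> distributions_on W"
    and g_cont: "continuous_on (X \<times> W) (\<lambda>(y, w). g y w)"
    and params: "0 < \<delta>" "0 < \<beta>" "\<beta> < 1" "0 < \<zeta>" "\<zeta> < 1" "1 \<le> K" "1 \<le> N0"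
    and DD: "\<And>d. d \<noteq> [] \<Longrightarrow> set d \<subseteq> W \<Longrightarrow>
      DD d \<subseteq> distributions_on W \<and> DD d \<noteq> {} \<and> closedin (weak_topology W) (DD d)"
    and init: "robustly_safe_trajectory f X U W g \<delta> xS xF x0 u0 T0"
    and \<Omega>: "\<Omega> = (\<Pi>\<^sub>M i\<in>UNIV. P)"
    and scheme: "\<And>\<omega>. \<omega> \<in> space \<Omega> \<Longrightarrow>
      DR_RC_Iterative_MPC f r X U g \<beta> \<delta> K xS xF DD N0 (initial_safe_set r x0 u0 T0)
        \<omega> (x \<omega>) (u \<omega>) (T \<omega>) (N \<omega>) (I \<omega>) (S \<omega>)"
    and D: "\<And>\<omega> j. D \<omega> j = DD (dataset \<omega> (N \<omega> j))"
    and attained: "\<And>\<omega> j y. \<omega> \<in> space \<Omega> \<Longrightarrow> 1 \<le> j \<Longrightarrow>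
      (\<exists>xs us. fh_feasible f X U g \<beta> \<delta> K (S \<omega> (j - 1)) (D \<omega> (j - 1)) y xs us) \<Longrightarrow>
      (\<exists>xs us. fh_optimal f r X U g \<beta> \<delta> K (S \<omega> (j - 1)) (D \<omega> (j - 1)) y xs us)"
    and confidence: "\<And>j. 1 \<le> j \<Longrightarrow> prob_at_least \<Omega> \<zeta> {\<omega> \<in> space \<Omega>. P \<in> D \<omega> (j - 1)}"
  shows "(\<forall>\<omega>\<in>space \<Omega>. \<forall>j\<ge>1. \<forall>t. \<exists>xs us.
            fh_feasible f X U g \<beta> \<delta> K (S \<omega> (j - 1)) (D \<omega> (j - 1)) (x \<omega> j t) xs us)
       \<and> (\<forall>j\<ge>1. \<forall>t. prob_at_least \<Omega> \<zeta> {\<omega> \<in> space \<Omega>. cvar \<beta> P (g (x \<omega> j t)) \<le> \<delta>})"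
proof -
  have feasible: "\<exists>xs us. fh_feasible f X U g \<beta> \<delta> K (S \<omega> (j - 1)) (D \<omega> (j - 1)) (x \<omega> j t) xs us"
    if \<omega>: "\<omega> \<in> space \<Omega>" and j: "1 \<le> j" for \<omega> j t
  proof -
    have "\<omega> i \<in> W" for i
      using \<omega> distributions_onD(3)[OF P] unfolding \<Omega> space_PiM by auto
    then have "set (dataset \<omega> (N \<omega> i)) \<subseteq> W" for i unfolding dataset_def by auto
    then have D_sub: "D \<omega> i \<subseteq> distributions_on W" for i
      using DD dataset_nonempty[OF scheme[OF \<omega>] params(7)] unfolding D by blast
    have S0_safe: "risk_safe g \<beta> \<delta> (initial_safe_set r x0 u0 T0) (D \<omega> i)" for i
      unfolding risk_safe_def
    proof
      fix y assume "y \<in> safe_states (initial_safe_set r x0 u0 T0)"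
      then have y: "y \<in> X" "\<And>w. w \<in> W \<Longrightarrow> g y w \<le> \<delta>"
        using init
        unfolding safe_states_def initial_safe_set_def robustly_safe_trajectory_def by auto
      have "continuous_on W ((\<lambda>(y, w). g y w) \<circ> Pair y)"
        using y(1) by (intro continuous_on_compose continuous_on_subset[OF g_cont])
          (auto intro!: continuous_intros)
      then have "continuous_on W (g y)" by (simp add: o_def)
      then show "worst_case_cvar \<beta> (D \<omega> i) (g y) \<le> ereal \<delta>"
        using worst_case_cvar_le[OF W] y(2) params(2,3) D_sub by simp
    qed
    have "Suc (j - 1) = j" using j by simp
    then show ?thesis
      using safe_set_invariant[where j = "j - 1" and D = "D \<omega>",
          OF points(2-4) params(6) init refl scheme[OF \<omega>] D S0_safe attained[OF \<omega>]]
      by simp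
  qed
  moreover have "prob_at_least \<Omega> \<zeta> {\<omega> \<in> space \<Omega>. cvar \<beta> P (g (x \<omega> j t)) \<le> \<delta>}"
    if j: "1 \<le> j" for j t
  proof -
    have "cvar \<beta> P (g (x \<omega> j t)) \<le> \<delta>" if \<omega>: "\<omega> \<in> space \<Omega>" "P \<in> D \<omega> (j - 1)" for \<omega>
    proof -
      obtain xs us where
        "fh_feasible f X U g \<beta> \<delta> K (S \<omega> (j - 1)) (D \<omega> (j - 1)) (x \<omega> j t) xs us"
        using feasible[OF \<omega>(1) j] by blast
      from feasible_imp_safe(3)[OF this params(6)] show ?thesis
        using \<omega>(2) by (rule cvar_le_of_worst_case)
    qed
    then show ?thesis by (intro prob_at_least_mono[OF confidence[OF j]]) blast
  qed
  ultimately show ?thesis by blast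
qed

end
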